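(* Let $r \in \mathbb{N}$ with $r \geq 2$ and let $X$ be a path-connected absolute neighborhood retract (ANR). Let $\varphi\colon X^r \to X^r$ be continuous and homotopic to the identity and let $F\colon X^r \to \mathbb{R}$ be a Lyapunov function for $\varphi$ which is bounded from below. Assume that $F(\mathrm{Fix}\,\varphi)\subset\mathbb{R}$ is discrete and that $(\varphi,F)$ satisfies condition (D). a) For all $\lambda \in \mathbb{R}$ it holds that $$\mathsf{TC}_{r,X}(F^\lambda) \leq \sum_{\mu \in (-\infty,\lambda]} \mathsf{TC}_{r,X}(F_\mu \cap \mathrm{Fix}\, \varphi).$$ b) If $\lambda \in \mathbb{R}$ is such that $\mathcal{C}_\mu(\varphi,F)$ is finite for all $\mu \leq \lambda$, then $$\mathsf{TC}_{r,X}(F^\lambda) \leq \sum_{\mu \in (-\infty, \lambda]}\max \{\mathsf{TC}_{r,X}(C) \mid C \in \mathcal{C}_\mu(\varphi,F)\}.$$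
   Context: Sublevel and level sets: for a function $F\colon Y\to\mathbb{R}$ and $\lambda\in\mathbb{R}$ put $F^\lambda=\{y\in Y\mid F(y)\le\lambda\}$ and $F_\lambda=\{y\in Y\mid F(y)=\lambda\}$. For a map $\varphi\colon Y\to Y$ put $\mathrm{Fix}\,\varphi=\{y\in Y\mid\varphi(y)=y\}$. $\mathcal{C}_\mu(\varphi,F)$ denotes the set of connected components of $F_\mu\cap\mathrm{Fix}\,\varphi$. Lyapunov functions and condition (D): let $Y$ be a topological space and $\varphi\colon Y\to Y$ continuous. A continuous function $F\colon Y\to\mathbb{R}$ is a Lyapunov function for $\varphi$ if $F(\varphi(y))\le F(y)$ for all $y\in Y$. The pair $(\varphi,F)$ satisfies condition (D) if: ($D_1$) $F(\varphi(y))<F(y)$ for all $y\in Y\setminus\mathrm{Fix}\,\varphi$; ($D_2$) if $A\subset Y$ is such that $F$ is bounded on $A$ and $\inf\{F(a)-F(\varphi(a))\mid a\in A\}=0$, then $\overline{A}\cap\mathrm{Fix}\,\varphi\ne\emptyset$. Sequential subspace complexity: for a path-connected space $X$ and $r\ge2$ let $PX=C^0([0,1],X)$ with the compact-open topology and let $p_r\colon PX\to X^r$, $p_r(\gamma)=(\gamma(0),\gamma(\tfrac1{r-1}),\dots,\gamma(\tfrac{r-2}{r-1}),\gamma(1))$. For $A\subset X^r$, a sequential motion planner on $A$ is a local section $s\colon A\to PX$ of $p_r$ (i.e. $p_r(s(a))=a$ for all $a\in A$). $\mathsf{TC}_{r,X}(A)$ is the minimal $n$ for which there exist open subsets $U_1,\dots,U_n\subset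 X^r$ with $A\subset\bigcup_{i=1}^nU_i$ such that each $U_i$ admits a continuous sequential motion planner $s_i\colon U_i\to PX$; if no such $n$ exists, $\mathsf{TC}_{r,X}(A)=\infty$. Conventions: $\mathsf{TC}_{r,X}(\emptyset)=0$ and the maximum over an empty set is $0$; the sums have non-negative terms in $\mathbb{N}_0\cup\{\infty\}$. An ANR is in particular metrizable. *)

theory Defs
  imports "HOL-Analysis.Analysis"
begin

text \<open>
  Absolute neighbourhood retracts for metrizable spaces: the image of every closed embedding of
  \<open>X\<close> into a metrizable space \<open>Z\<close> is a retract of an open neighbourhood in \<open>Z\<close>.
  (The library's ANR is relative to ambient spaces \<open>'a \<times> real\<close>, so it is the intended notion
  only for subsets of Euclidean spaces.)

  HOL cannot quantify over all types for the points of \<open>Z\<close>, but the type \<open>'a \<Rightarrow> real\<close>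
  (with every metrizable topology on every subset of it as carrier) is large enough:
  by the Kuratowski-Wojdyslawski theorem \<open>X\<close> embeds as a closed subset of a convex set of
  bounded real functions on \<open>X\<close>, with the sup metric, and by Dugundji's extension theorem a
  neighbourhood retraction there already yields one for every closed embedding of \<open>X\<close> into a
  metrizable space over any type.
\<close>

definition ANR_space :: "'a topology \<Rightarrow> bool" where
  "ANR_space X \<longleftrightarrow>
     metrizable_space X \<and>
     (\<forall>(Z :: ('a \<Rightarrow> real) topology) e.
        metrizable_space Z \<and> embedding_map X Z e \<and> closedin Z (e ` topspace X) \<longrightarrow>
        (\<exists>V. openin Z V \<and> e ` topspace X \<subseteq> V \<and>
             (e ` topspace X) retract_of_space (subtopology Z V)))"

text \<open>
  The points of \<open>power_space r X\<close> are the families indexed by \<open>{..<r}\<close>, as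
  extensional functions.
\<close>

abbreviation power_space :: "nat \<Rightarrow> 'a topology \<Rightarrow> (nat \<Rightarrow> 'a) topology" where
  "power_space r X \<equiv> product_topology (\<lambda>_. X) {..<r}"

definition fix_set :: "'b topology \<Rightarrow> ('b \<Rightarrow> 'b) \<Rightarrow> 'b set" where
  "fix_set Y \<phi> = {y \<in> topspace Y. \<phi> y = y}"

definition sublevel :: "'b topology \<Rightarrow> ('b \<Rightarrow> real) \<Rightarrow> real \<Rightarrow> 'b set" where
  "sublevel Y F c = {y \<in> topspace Y. F y \<le> c}"

definition level :: "'b topology \<Rightarrow> ('b \<Rightarrow> real) \<Rightarrow> real \<Rightarrow> 'b set" where
  "level Y F c = {y \<in> topspace Y. F y = c}"

definition fix_components ::
    "'b topology \<Rightarrow> ('b \<Rightarrow> 'b) \<Rightarrow> ('b \<Rightarrow> real) \<Rightarrow> real \<Rightarrow> 'b set set" where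
  "fix_components Y \<phi> F c =
     connected_components_of (subtopology Y (level Y F c \<inter> fix_set Y \<phi>))"

definition lyapunov_function :: "'b topology \<Rightarrow> ('b \<Rightarrow> 'b) \<Rightarrow> ('b \<Rightarrow> real) \<Rightarrow> bool" where
  "lyapunov_function Y \<phi> F \<longleftrightarrow>
     continuous_map Y euclideanreal F \<and> (\<forall>y \<in> topspace Y. F (\<phi> y) \<le> F y)"

text \<open>
  The set \<open>A\<close> in the second clause is required to be nonempty, since the real \<open>Inf {}\<close> is
  unspecified (the infimum of the empty set is \<open>+\<infinity>\<close>, hence not \<open>0\<close>). The set of
  differences is bounded below by \<open>0\<close> because of the first clause.
\<close>

definition condition_D :: "'b topology \<Rightarrow> ('b \<Rightarrow> 'b) \<Rightarrow> ('b \<Rightarrow> real) \<Rightarrow> bool" where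
  "condition_D Y \<phi> F \<longleftrightarrow>
     (\<forall>y \<in> topspace Y - fix_set Y \<phi>. F (\<phi> y) < F y) \<and>
     (\<forall>A. A \<subseteq> topspace Y \<and> A \<noteq> {} \<and> bounded (F ` A) \<and> (INF a\<in>A. F a - F (\<phi> a)) = 0 \<longrightarrow>
          (Y closure_of A) \<inter> fix_set Y \<phi> \<noteq> {})"

text \<open>
  Continuous maps are represented by functions that are extensional on the domain. The case
  \<open>K = {}\<close> contributes the whole carrier to the subbase.
\<close>

definition compact_open_topology :: "'a topology \<Rightarrow> 'b topology \<Rightarrow> ('a \<Rightarrow> 'b) topology" where
  "compact_open_topology T X =
     topology_generated_by
       {{f. continuous_map T X f \<and> f \<in> extensional (topspace T) \<and> f ` K \<subseteq> U} | K U.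
          compactin T K \<and> openin X U}"

lemma topspace_compact_open_topology:
  "topspace (compact_open_topology T X) =
     {f. continuous_map T X f \<and> f \<in> extensional (topspace T)}"
proof -
  let ?B = "{{f. continuous_map T X f \<and> f \<in> extensional (topspace T) \<and> f ` K \<subseteq> U} | K U.
               compactin T K \<and> openin X U}"
  have "{f. continuous_map T X f \<and> f \<in> extensional (topspace T)} \<in> ?B"
    by (rule CollectI, rule exI[of _ "{}"], rule exI[of _ "{}"]) auto
  then have "\<Union> ?B = {f. continuous_map T X f \<and> f \<in> extensional (topspace T)}"
    by blast
  then show ?thesis
    by (simp add: compact_open_topology_def topology_generated_by_topspace)
qed

definition path_space :: "'a topology \<Rightarrow> (real \<Rightarrow> 'a) topology" where
  "path_space X = compact_open_topology (top_of_set {0..1}) X"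

definition path_eval :: "nat \<Rightarrow> (real \<Rightarrow> 'a) \<Rightarrow> nat \<Rightarrow> 'a" where
  "path_eval r \<gamma> = (\<lambda>i\<in>{..<r}. \<gamma> (real i / real (r - 1)))"

definition sequential_motion_planner ::
    "nat \<Rightarrow> 'a topology \<Rightarrow> (nat \<Rightarrow> 'a) set \<Rightarrow> ((nat \<Rightarrow> 'a) \<Rightarrow> real \<Rightarrow> 'a) \<Rightarrow> bool" where
  "sequential_motion_planner r X A s \<longleftrightarrow>
     s \<in> A \<rightarrow> topspace (path_space X) \<and> (\<forall>a\<in>A. path_eval r (s a) = a)"

text \<open>
  The infimum in \<open>enat\<close> is the minimum, and it is \<open>\<infinity>\<close> if there is no such \<open>n\<close>.
  Since \<open>n = 0\<close> is allowed, the value is \<open>0\<close> for the empty set.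
\<close>

definition seq_TC :: "nat \<Rightarrow> 'a topology \<Rightarrow> (nat \<Rightarrow> 'a) set \<Rightarrow> enat" where
  "seq_TC r X A =
     Inf {enat n | n. \<exists>U :: nat \<Rightarrow> (nat \<Rightarrow> 'a) set.
            (\<forall>i<n. openin (power_space r X) (U i) \<and>
                   (\<exists>s. sequential_motion_planner r X (U i) s \<and>
                        continuous_map (subtopology (power_space r X) (U i)) (path_space X) s)) \<and>
            A \<subseteq> (\<Union>i<n. U i)}"

end

theory Submission
  imports Defs
begin

text \<open>
  An open set \<open>U\<close> admits a continuous sequential motion planner iff all coordinate projections
  \<open>U \<rightarrow> X\<close> are homotopic. Hence \<open>seq_TC\<close> cannot decrease along a map \<open>\<phi>\<close> that is homotopic to the
  identity, and the Lusternik-Schnirelmann argument applies: by condition (D), near each level \<open>x\<close>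
  a single application of \<open>\<phi>\<close> pushes the sublevel set at \<open>x + d\<close>, minus a neighbourhood of the fixed
  points at level \<open>x\<close>, below the level \<open>x - d\<close>. If infinitely many levels up to \<open>c\<close> contain fixed
  points, the right-hand side is infinite; otherwise one looks at the infimum of the levels at which
  the estimate fails. Part (b) follows from part (a), since finitely many disjoint closed sets in a
  metrizable space have disjoint neighbourhoods.
\<close>

subsection \<open>Exponential law and homotopies\<close>

text \<open>Compact neighbourhoods in \<open>S\<close> make evaluation continuous: if
  \<open>s a t\<close> lies in the open set \<open>W\<close>, some compact neighbourhood
  \<open>K\<close> of \<open>t\<close> is sent into \<open>W\<close> by \<open>s a\<close>. The maps
  sending \<open>K\<close> into \<open>W\<close> form a subbasic open set, and its preimage under
  \<open>s\<close> times the interior part \<open>V\<close> of \<open>K\<close> is a product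
  neighbourhood of the point.\<close>

lemma continuous_map_compact_open_uncurry:
  assumes s: "continuous_map T (compact_open_topology S X) s"
    and S: "neighbourhood_base_of (compactin S) S"
  shows "continuous_map (prod_topology T S) X (\<lambda>(a, t). s a t)"
proof -
  have cont: "continuous_map S X (s a)" if "a \<in> topspace T" for a
    using continuous_map_image_subset_topspace[OF s] that
    by (auto simp: topspace_compact_open_topology)
  show ?thesis
    unfolding continuous_map
  proof (intro conjI allI impI)
    show "(\<lambda>(a, t). s a t) ` topspace (prod_topology T S) \<subseteq> topspace X"
      using cont by (auto simp: continuous_map_def Pi_iff)
  next
    fix W assume W: "openin X W"
    let ?P = "{z \<in> topspace (prod_topology T S). (case z of (a, t) \<Rightarrow> s a t) \<in> W}"
    show "openin (prod_topology T S) ?P"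
    proof (subst openin_subopen, intro ballI)
      fix z assume "z \<in> ?P"
      then obtain a t where z: "z = (a, t)" and a: "a \<in> topspace T" and t: "t \<in> topspace S"
          and st: "s a t \<in> W"
        by auto
      let ?Q = "{t \<in> topspace S. s a t \<in> W}"
      have "openin S ?Q"
        using cont[OF a] W by (rule openin_continuous_map_preimage)
      moreover have "t \<in> ?Q"
        using t st by simp
      ultimately obtain V K where V: "openin S V" "compactin S K" "t \<in> V" "V \<subseteq> K" "K \<subseteq> ?Q"
        using S[unfolded neighbourhood_base_of, rule_format, of ?Q t] by metis
      let ?B = "{f. continuous_map S X f \<and> f \<in> extensional (topspace S) \<and> f ` K \<subseteq> W}"
      let ?A = "{a \<in> topspace T. s a \<in> ?B}"
      have "openin (compact_open_topology S X) ?B"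
        unfolding compact_open_topology_def
        by (rule topology_generated_by_Basis) (use V W in blast)
      then have A: "openin T ?A"
        by (rule openin_continuous_map_preimage[OF s])
      have "s a \<in> topspace (compact_open_topology S X)"
        using s a by (simp add: continuous_map_def Pi_iff)
      moreover have "s a ` K \<subseteq> W"
        using V(5) by blast
      ultimately have "a \<in> ?A"
        using a by (simp add: topspace_compact_open_topology)
      then have "z \<in> ?A \<times> V"
        using z V(3) by simp
      moreover have "openin (prod_topology T S) (?A \<times> V)"
        using A V(1) by (simp add: openin_prod_Times_iff)
      moreover have "?A \<times> V \<subseteq> ?P"
        using V(4) openin_subset[OF V(1)] by auto
      ultimately show "\<exists>N. openin (prod_topology T S) N \<and> z \<in> N \<and> N \<subseteq> ?P"
        by blast
    qed
  qed
qed

text \<open>Continuity is checked on the subbase. If \<open>f a\<close> sends the compact set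
  \<open>K\<close> into \<open>U\<close>, the tube lemma thickens the slice over \<open>a\<close> to
  an open \<open>V\<close>, and \<open>f b\<close> sends \<open>K\<close> into \<open>U\<close> for
  every \<open>b\<close> in \<open>V\<close>.\<close>

lemma continuous_map_compact_open_curry:
  assumes "continuous_map (prod_topology T S) X (\<lambda>(a, t). f a t)"
  shows "continuous_map T (compact_open_topology S X) (\<lambda>a. restrict (f a) (topspace S))"
proof -
  let ?g = "\<lambda>a. restrict (f a) (topspace S)"
  have cont: "continuous_map S X (?g a)" if "a \<in> topspace T" for a
  proof -
    have "continuous_map S X ((\<lambda>(a, t). f a t) \<circ> (\<lambda>t. (a, t)))"
      by (rule continuous_map_compose[OF _ assms]) (use that in \<open>simp add: continuous_map_pairwise o_def\<close>)
    then show ?thesis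
      by (rule continuous_map_eq) auto
  qed
  let ?B = "\<lambda>K U. {h. continuous_map S X h \<and> h \<in> extensional (topspace S) \<and> h ` K \<subseteq> U}"
  have "openin T (?g -` ?B K U \<inter> topspace T)" if K: "compactin S K" and U: "openin X U" for K U
  proof (subst openin_subopen, intro ballI)
    fix a assume a: "a \<in> ?g -` ?B K U \<inter> topspace T"
    let ?W = "{z \<in> topspace (prod_topology T S). (\<lambda>(a, t). f a t) z \<in> U}"
    have KS: "K \<subseteq> topspace S"
      using K by (rule compactin_subset_topspace)
    have "openin (prod_topology T S) ?W"
      using assms U by (rule openin_continuous_map_preimage)
    moreover have "{a} \<times> K \<subseteq> ?W"
      using a KS by (auto simp: image_subset_iff subset_iff)
    ultimately obtain V V' where V: "openin T V" "a \<in> V" "K \<subseteq> V'" "V \<times> V' \<subseteq> ?W"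
      using tube_lemma_right[of T S ?W K a] K a by blast
    have "V \<subseteq> ?g -` ?B K U \<inter> topspace T"
      using V KS openin_subset[OF V(1)] cont by (auto simp: subset_iff)
    with V show "\<exists>V. openin T V \<and> a \<in> V \<and> V \<subseteq> ?g -` ?B K U \<inter> topspace T"
      by blast
  qed
  moreover have "?g ` topspace T \<subseteq> topspace (compact_open_topology S X)"
    using cont by (auto simp: topspace_compact_open_topology)
  ultimately show ?thesis
    unfolding compact_open_topology_def topology_generated_by_topspace
    by (intro continuous_on_generated_topo) blast+
qed

lemma continuous_map_snd_real:
  "continuous_map (prod_topology T (top_of_set S)) euclideanreal (snd :: 'b \<times> real \<Rightarrow> real)"
  by (rule continuous_map_into_fulltopology[OF continuous_map_snd])

text \<open>Gluing over \<open>{0..real n}\<close> with unit speed avoids rescaling: the induction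
  step appends one unit interval and leaves the earlier times unchanged.\<close>

lemma concatenate_homotopies:
  fixes f :: "nat \<Rightarrow> 'b \<Rightarrow> 'a"
  assumes "\<And>i. i < n \<Longrightarrow> homotopic_with (\<lambda>_. True) T X (f i) (f (Suc i))"
    and "continuous_map T X (f 0)"
  shows "\<exists>G. continuous_map (prod_topology T (top_of_set {0..real n})) X G \<and>
             (\<forall>a\<in>topspace T. \<forall>i\<le>n. G (a, real i) = f i a)"
  using assms
proof (induction n)
  case 0
  have "continuous_map (prod_topology T (top_of_set {0..real 0})) X (f 0 \<circ> fst)"
    using 0 continuous_map_compose continuous_map_fst by blast
  moreover have "\<forall>a\<in>topspace T. \<forall>i\<le>0. (f 0 \<circ> fst) (a, real i) = f i a"
    by simp
  ultimately show ?case
    by blast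
next
  case (Suc n)
  then obtain G where G: "continuous_map (prod_topology T (top_of_set {0..real n})) X G"
      and Gf: "\<And>a i. a \<in> topspace T \<Longrightarrow> i \<le> n \<Longrightarrow> G (a, real i) = f i a"
    by (metis less_Suc_eq)
  obtain h where h: "continuous_map (prod_topology (top_of_set {0..1::real}) T) X h"
      and h0: "\<And>x. h (0, x) = f n x" and h1: "\<And>x. h (1, x) = f (Suc n) x"
    using Suc.prems(1)[of n] unfolding homotopic_with_def by auto
  let ?P = "prod_topology T (top_of_set {0..real (Suc n)})"
  let ?G = "\<lambda>z. if snd z \<le> real n then G z else h (snd z - real n, fst z)"
  have "continuous_map ?P X ?G"
  proof (rule continuous_map_cases_le)
    show "continuous_map ?P euclideanreal snd"
      by (rule continuous_map_snd_real)
    show "continuous_map ?P euclideanreal (\<lambda>_. real n)"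
      by simp
    have "continuous_map (subtopology ?P {z \<in> topspace ?P. snd z \<le> real n})
            (prod_topology T (top_of_set {0..real n})) id"
      by (auto simp: continuous_map_pairwise continuous_map_in_subtopology o_def
          intro!: continuous_map_from_subtopology continuous_map_fst continuous_map_snd_real)
    then show "continuous_map (subtopology ?P {z \<in> topspace ?P. snd z \<le> real n}) X G"
      using continuous_map_compose[OF _ G] by fastforce
    have "continuous_map (subtopology ?P {z \<in> topspace ?P. real n \<le> snd z})
            (prod_topology (top_of_set {0..1}) T) (\<lambda>z. (snd z - real n, fst z))"
      by (auto simp: continuous_map_pairwise continuous_map_in_subtopology o_def
          intro!: continuous_map_from_subtopology continuous_map_fst continuous_map_snd_real
            continuous_map_diff)
    from continuous_map_compose[OF this h]
    show "continuous_map (subtopology ?P {z \<in> topspace ?P. real n \<le> snd z}) X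
            (\<lambda>z. h (snd z - real n, fst z))"
      by (simp add: o_def)
    show "G z = h (snd z - real n, fst z)" if "z \<in> topspace ?P" "snd z = real n" for z
      using that Gf[of "fst z" n] h0 by (cases z) auto
  qed
  moreover have "?G (a, real i) = f i a" if "a \<in> topspace T" "i \<le> Suc n" for a i
    using that Gf h1 by (cases "i = Suc n") auto
  ultimately show ?case
    by blast
qed

subsection \<open>Motion planners\<close>

text \<open>The condition that \<open>seq_TC\<close> puts on each member of a cover, openness
  included.\<close>

definition plannable :: "nat \<Rightarrow> 'a topology \<Rightarrow> (nat \<Rightarrow> 'a) set \<Rightarrow> bool" where
  "plannable r X U \<longleftrightarrow>
     openin (power_space r X) U \<and>
     (\<exists>s. sequential_motion_planner r X U s \<and>
          continuous_map (subtopology (power_space r X) U) (path_space X) s)"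

lemma topspace_subtopology_openin: "openin Y U \<Longrightarrow> topspace (subtopology Y U) = U"
  using openin_subset by fastforce

text \<open>The uncurried planner is itself the homotopy: the planned path of \<open>a\<close>
  passes through \<open>a i\<close> and \<open>a j\<close>, so it suffices to travel along it from
  the one sampling time to the other.\<close>

lemma plannable_imp_homotopic_projections:
  assumes "plannable r X U" "i < r" "j < r"
  shows "homotopic_with (\<lambda>_. True) (subtopology (power_space r X) U) X (\<lambda>a. a i) (\<lambda>a. a j)"
proof -
  let ?T = "subtopology (power_space r X) U"
  let ?I = "top_of_set {0..1::real}"
  obtain s where U: "openin (power_space r X) U"
      and s: "continuous_map ?T (path_space X) s"
      and ev: "\<And>a. a \<in> U \<Longrightarrow> path_eval r (s a) = a"
    using assms(1) by (auto simp: plannable_def sequential_motion_planner_def)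
  \<comment> \<open>The unit interval is compact Hausdorff, hence has a base of compact
    neighbourhoods, as uncurrying requires.\<close>
  have nb: "neighbourhood_base_of (compactin ?I) ?I"
    by (intro locally_compact_space_neighbourhood_base[THEN iffD1])
       (simp_all add: compact_imp_locally_compact_space Hausdorff_space_subtopology compact_space_subtopology)
  have G: "continuous_map (prod_topology ?T ?I) X (\<lambda>(a, t). s a t)"
    using s nb unfolding path_space_def by (rule continuous_map_compact_open_uncurry)
  define q where "q k = real k / real (r - 1)" for k
  have q: "s a (q k) = a k" if "a \<in> U" "k < r" for a k
    using fun_cong[OF ev[OF that(1)], of k] that(2) by (simp add: path_eval_def q_def)
  have q01: "0 \<le> q k" "q k \<le> 1" if "k < r" for k
    using that by (auto simp: q_def divide_simps)
  \<comment> \<open>Linear motion from the sampling time \<open>q i\<close> to \<open>q j\<close>;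
    it runs backwards when \<open>j < i\<close>, and by convexity it stays in the unit
    interval.\<close>
  let ?u = "\<lambda>t. (1 - t) * q i + t * q j"
  have u: "?u t \<in> {0..1}" if "t \<in> {0..1}" for t
    using that q01[OF assms(2)] q01[OF assms(3)] convex_bound_le[of "q i" 1 "q j" "1 - t" t]
    by auto
  have "continuous_map (prod_topology ?I ?T) (prod_topology ?T ?I) (\<lambda>z. (snd z, ?u (fst z)))"
    using u
    by (auto simp: continuous_map_pairwise o_def continuous_map_in_subtopology[of _ euclideanreal]
        intro!: continuous_map_snd continuous_intros
          continuous_map_into_fulltopology[OF continuous_map_fst])
  from continuous_map_compose[OF this G]
  have "continuous_map (prod_topology ?I ?T) X (\<lambda>z. s (snd z) (?u (fst z)))"
    by (simp add: o_def)
  moreover have "\<forall>a\<in>topspace ?T. s a (?u 0) = a i" "\<forall>a\<in>topspace ?T. s a (?u 1) = a j"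
    using q assms(2,3) unfolding topspace_subtopology_openin[OF U] by simp_all
  ultimately show ?thesis
    unfolding homotopic_with[where P = "\<lambda>_. True", simplified]
    by (intro exI[of _ "\<lambda>z. s (snd z) (?u (fst z))"]) simp
qed

text \<open>The \<open>r - 1\<close> homotopies between consecutive projections are concatenated.
  Speeding time up by the factor \<open>r - 1\<close> puts the visit to coordinate \<open>i\<close>
  at time \<open>i / (r - 1)\<close>, and currying turns the result into a planner.\<close>

lemma homotopic_projections_imp_plannable:
  assumes "r \<ge> 2" and U: "openin (power_space r X) U"
    and hom: "\<And>i j. i < r \<Longrightarrow> j < r \<Longrightarrow>
      homotopic_with (\<lambda>_. True) (subtopology (power_space r X) U) X (\<lambda>a. a i) (\<lambda>a. a j)"
  shows "plannable r X U"
proof -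
  let ?T = "subtopology (power_space r X) U"
  let ?I = "top_of_set {0..1::real}"
  let ?m = "real (r - 1)"
  have tT: "topspace ?T = U"
    by (rule topspace_subtopology_openin[OF U])
  have "continuous_map ?T X (\<lambda>a. a 0)"
    using homotopic_with_imp_continuous_maps[OF hom[of 0 0]] assms(1) by simp
  moreover have "homotopic_with (\<lambda>_. True) ?T X (\<lambda>a. a i) (\<lambda>a. a (Suc i))" if "i < r - 1" for i
    using hom[of i "Suc i"] that by simp
  ultimately have "\<exists>G. continuous_map (prod_topology ?T (top_of_set {0..?m})) X G \<and>
      (\<forall>a\<in>topspace ?T. \<forall>i\<le>r - 1. G (a, real i) = a i)"
    by (intro concatenate_homotopies)
  then obtain G where G: "continuous_map (prod_topology ?T (top_of_set {0..?m})) X G"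
      and Gi: "\<And>a i. a \<in> U \<Longrightarrow> i \<le> r - 1 \<Longrightarrow> G (a, real i) = a i"
    unfolding tT by blast
  have "continuous_map (prod_topology ?T ?I) (top_of_set {0..?m}) (\<lambda>z. ?m * snd z)"
    unfolding continuous_map_in_subtopology
  proof
    show "continuous_map (prod_topology ?T ?I) euclideanreal (\<lambda>z. ?m * snd z)"
      by (intro continuous_map_real_mult_left continuous_map_snd_real)
    show "(\<lambda>z. ?m * snd z) \<in> topspace (prod_topology ?T ?I) \<rightarrow> {0..?m}"
      by (simp add: Pi_iff mult_left_le)
  qed
  then have "continuous_map (prod_topology ?T ?I) (prod_topology ?T (top_of_set {0..?m}))
          (\<lambda>z. (fst z, ?m * snd z))"
    by (intro continuous_map_pairedI continuous_map_fst)
  from continuous_map_compose[OF this G]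
  have "continuous_map (prod_topology ?T ?I) X (\<lambda>(a, t). G (a, ?m * t))"
    by (simp add: o_def case_prod_unfold)
  from continuous_map_compact_open_curry[OF this]
  have s: "continuous_map ?T (path_space X) (\<lambda>a. restrict (\<lambda>t. G (a, ?m * t)) {0..1})"
    (is "continuous_map _ _ ?s")
    by (simp add: path_space_def)
  have "path_eval r (?s a) = a" if a: "a \<in> U" for a
  proof
    fix i
    \<comment> \<open>Points of the power space are extensional, so they agree with
      \<open>path_eval\<close> also at indices outside \<open>{..<r}\<close>.\<close>
    have ext: "a \<in> extensional {..<r}"
      using openin_subset[OF U] a by (auto simp: PiE_def)
    show "path_eval r (?s a) i = a i"
    proof (cases "i < r")
      case True
      then have "real i \<le> ?m" "0 < ?m" "i \<le> r - 1"
        using assms(1) by linarith+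
      then have "real i / ?m \<in> {0..1}" "?m * (real i / ?m) = real i"
        by (simp_all add: divide_le_eq)
      then show ?thesis
        using True Gi[OF a \<open>i \<le> r - 1\<close>] unfolding path_eval_def by (simp only: restrict_apply' lessThan_iff)
    qed (use ext in \<open>simp add: path_eval_def extensional_def\<close>)
  qed
  moreover have "?s \<in> U \<rightarrow> topspace (path_space X)"
    using s unfolding continuous_map_def tT by (rule conjunct1)
  ultimately have "sequential_motion_planner r X U ?s"
    unfolding sequential_motion_planner_def by blast
  with s U show ?thesis
    unfolding plannable_def by (intro conjI exI[of _ ?s])
qed

text \<open>On the preimage the projections are linked by the chain \<open>a i\<close>,
  \<open>\<phi> a i\<close>, \<open>\<phi> a j\<close>, \<open>a j\<close>. The outer links come
  from the homotopy between \<open>\<phi>\<close> and the identity, the middle one from the planner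
  on \<open>U\<close> precomposed with \<open>\<phi>\<close>.\<close>

lemma plannable_preimage:
  assumes "r \<ge> 2" "plannable r X U"
    and hom: "homotopic_with (\<lambda>_. True) (power_space r X) (power_space r X) \<phi> id"
  shows "plannable r X {a \<in> topspace (power_space r X). \<phi> a \<in> U}"
proof -
  let ?Y = "power_space r X"
  let ?V = "{a \<in> topspace ?Y. \<phi> a \<in> U}"
  let ?h = "homotopic_with (\<lambda>_. True) (subtopology ?Y ?V) X"
  have \<phi>: "continuous_map ?Y ?Y \<phi>"
    using homotopic_with_imp_continuous_maps[OF hom] by simp
  have U: "openin ?Y U"
    using assms(2) by (simp add: plannable_def)
  have V: "openin ?Y ?V"
    by (rule openin_continuous_map_preimage[OF \<phi> U])
  have \<phi>V: "continuous_map (subtopology ?Y ?V) (subtopology ?Y U) \<phi>"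
    using continuous_map_from_subtopology[OF \<phi>, of ?V] by (auto simp: continuous_map_in_subtopology)
  have pr: "?h (\<lambda>a. \<phi> a i) (\<lambda>a. a i)" if "i < r" for i
  proof -
    have "continuous_map (subtopology ?Y ?V) ?Y id"
      by (simp add: continuous_map_from_subtopology)
    from homotopic_with_compose_continuous_map_right[OF hom this]
    have "homotopic_with (\<lambda>_. True) (subtopology ?Y ?V) ?Y \<phi> id"
      by simp
    from homotopic_with_compose_continuous_map_left[OF this, of X "\<lambda>a. a i" "\<lambda>_. True"]
    show ?thesis
      using that continuous_map_product_projection[of i "{..<r}" "\<lambda>_. X"] by (simp add: o_def)
  qed
  have "?h (\<lambda>a. a i) (\<lambda>a. a j)" if "i < r" "j < r" for i j
  proof -
    have "?h (\<lambda>a. \<phi> a i) (\<lambda>a. \<phi> a j)"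
      using homotopic_with_compose_continuous_map_right
          [OF plannable_imp_homotopic_projections[OF assms(2) that] \<phi>V, of "\<lambda>_. True"]
      by (simp add: o_def)
    then show ?thesis
      using pr[OF that(1)] pr[OF that(2)] homotopic_with_symD homotopic_with_trans by blast
  qed
  then show ?thesis
    by (rule homotopic_projections_imp_plannable[OF assms(1) V])
qed

section \<open>Operations on plannable sets\<close>

lemma plannable_empty: "plannable r X {}"
  by (simp add: plannable_def sequential_motion_planner_def continuous_map_on_empty)

text \<open>Both sets are open and their overlap is empty, so the two planners paste to a continuous
  one.\<close>

lemma plannable_Un_disjnt:
  assumes "plannable r X U" "plannable r X V" "disjnt U V"
  shows "plannable r X (U \<union> V)"
proof -
  let ?Y = "power_space r X"
  obtain s t where s: "sequential_motion_planner r X U s"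
      "continuous_map (subtopology ?Y U) (path_space X) s"
    and t: "sequential_motion_planner r X V t"
      "continuous_map (subtopology ?Y V) (path_space X) t"
    and U: "openin ?Y U" and V: "openin ?Y V"
    using assms by (auto simp: plannable_def)
  let ?g = "\<lambda>a. if a \<in> U then s a else t a"
  let ?T = "\<lambda>b. if b then U else V"
  have "continuous_map (subtopology ?Y (U \<union> V)) (path_space X) ?g"
  proof (rule pasting_lemma[where I = UNIV and T = ?T and f = "\<lambda>b. if b then s else t"])
    show "openin (subtopology ?Y (U \<union> V)) (?T b)" for b
      unfolding openin_subtopology using U V by (intro exI[of _ "?T b"]) auto
    show "continuous_map (subtopology (subtopology ?Y (U \<union> V)) (?T b)) (path_space X) (if b then s else t)" for b
      using s t by (auto simp: subtopology_subtopology Int_absorb1)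
    show "(if i then s else t) x = (if j then s else t) x"
      if "x \<in> topspace (subtopology ?Y (U \<union> V)) \<inter> ?T i \<inter> ?T j" for i j x
      using that assms(3) unfolding disjnt_iff by (cases i; cases j) auto
    show "\<exists>b. b \<in> UNIV \<and> x \<in> ?T b \<and> ?g x = (if b then s else t) x"
      if "x \<in> topspace (subtopology ?Y (U \<union> V))" for x
      using that by (intro exI[of _ "x \<in> U"]) auto
  qed
  moreover have "sequential_motion_planner r X (U \<union> V) ?g"
    using s t by (auto simp: sequential_motion_planner_def)
  ultimately show ?thesis
    using U V unfolding plannable_def by blast
qed

lemma plannable_Int:
  assumes "plannable r X U" "openin (power_space r X) W"
  shows "plannable r X (U \<inter> W)"
proof -
  obtain s where s: "sequential_motion_planner r X U s"
      "continuous_map (subtopology (power_space r X) U) (path_space X) s"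
      and "openin (power_space r X) U"
    using assms by (auto simp: plannable_def)
  then have "openin (power_space r X) (U \<inter> W)"
      "sequential_motion_planner r X (U \<inter> W) s"
      "continuous_map (subtopology (power_space r X) (U \<inter> W)) (path_space X) s"
    using assms(2) continuous_map_from_subtopology[OF s(2), of W]
    by (auto simp: sequential_motion_planner_def subtopology_subtopology)
  then show ?thesis
    unfolding plannable_def by blast
qed

subsection \<open>Properties of sequential subspace complexity\<close>

text \<open>A finite bound makes the set of admissible cover sizes nonempty, so its infimum is
  attained; a cover that is too short is padded with empty sets. All later estimates are proved by
  manipulating covers through this equivalence.\<close>

lemma seq_TC_le_enat_iff:
  "seq_TC r X A \<le> enat n \<longleftrightarrow> (\<exists>U. (\<forall>i<n. plannable r X (U i)) \<and> A \<subseteq> (\<Union>i<n. U i))"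
proof -
  let ?cov = "\<lambda>n. \<exists>U. (\<forall>i<n. plannable r X (U i)) \<and> A \<subseteq> (\<Union>i<n. U i)"
  have eq: "seq_TC r X A = Inf {enat n | n. ?cov n}"
    by (simp add: seq_TC_def plannable_def)
  show ?thesis
  proof
    assume le: "seq_TC r X A \<le> enat n"
    have "{enat n | n. ?cov n} \<noteq> {}"
    proof
      assume empty: "{enat n | n. ?cov n} = {}"
      have "seq_TC r X A = \<infinity>"
        unfolding eq empty by (simp add: Inf_enat_def)
      with le show False by simp
    qed
    then have "Inf {enat n | n. ?cov n} \<in> {enat n | n. ?cov n}"
      by (metis (no_types, lifting) ex_in_conv wellorder_InfI)
    then obtain m U where m: "seq_TC r X A = enat m" and U: "\<forall>i<m. plannable r X (U i)" "A \<subseteq> (\<Union>i<m. U i)"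
      unfolding eq by blast
    have "m \<le> n"
      using le m by simp
    \<comment> \<open>Padding from \<open>m\<close> to exactly \<open>n\<close> members.\<close>
    then have "A \<subseteq> (\<Union>i<n. if i < m then U i else {})"
      using U(2) by (fastforce simp: subset_iff)
    moreover have "\<forall>i<n. plannable r X (if i < m then U i else {})"
      using U(1) plannable_empty by auto
    ultimately show "?cov n"
      by (intro exI[of _ "\<lambda>i. if i < m then U i else {}"] conjI)
  next
    assume "?cov n"
    then show "seq_TC r X A \<le> enat n"
      unfolding eq by (intro Inf_lower) blast
  qed
qed

lemma enat_le_by_finite:
  fixes x y :: enat
  assumes "\<And>n. y = enat n \<Longrightarrow> x \<le> enat n"
  shows "x \<le> y"
  using assms by (cases y) auto

lemma seq_TC_mono: "A \<subseteq> B \<Longrightarrow> seq_TC r X A \<le> seq_TC r X B"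
  by (rule enat_le_by_finite) (metis seq_TC_le_enat_iff order_refl subset_trans)

lemma seq_TC_empty: "seq_TC r X {} = 0"
  using seq_TC_le_enat_iff[of r X "{}" 0] by (simp add: zero_enat_def[symmetric])

lemma seq_TC_ge_1: "A \<noteq> {} \<Longrightarrow> 1 \<le> seq_TC r X A"
  using seq_TC_le_enat_iff[of r X A 0] by (simp add: one_eSuc ileI1 zero_enat_def[symmetric])

lemma seq_TC_Un: "seq_TC r X (A \<union> B) \<le> seq_TC r X A + seq_TC r X B"
proof (rule enat_le_by_finite)
  fix k assume k: "seq_TC r X A + seq_TC r X B = enat k"
  then obtain m n where mn: "seq_TC r X A = enat m" "seq_TC r X B = enat n" and k': "k = m + n"
    by (cases "seq_TC r X A"; cases "seq_TC r X B") auto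
  obtain U V where U: "\<forall>i<m. plannable r X (U i)" "A \<subseteq> (\<Union>i<m. U i)"
      and V: "\<forall>i<n. plannable r X (V i)" "B \<subseteq> (\<Union>i<n. V i)"
    using mn seq_TC_le_enat_iff by (metis order_refl)
  let ?W = "\<lambda>i. if i < m then U i else V (i - m)"
  have "\<forall>i<k. plannable r X (?W i)"
    using U(1) V(1) k' by auto
  moreover have "A \<union> B \<subseteq> (\<Union>i<k. ?W i)"
  proof
    fix a assume "a \<in> A \<union> B"
    then consider i where "i < m" "a \<in> U i" | j where "j < n" "a \<in> V j"
      using U(2) V(2) by blast
    then show "a \<in> (\<Union>i<k. ?W i)"
    proof cases
      case 1
      then show ?thesis
        using k' by (intro UN_I[of i]) auto
    next
      case 2
      then show ?thesis
        using k' by (intro UN_I[of "m + j"]) auto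
    qed
  qed
  ultimately show "seq_TC r X (A \<union> B) \<le> enat k"
    unfolding seq_TC_le_enat_iff by (intro exI[of _ ?W] conjI)
qed

text \<open>The union of an optimal cover is open, and the same cover bounds its complexity.\<close>

lemma seq_TC_open_neighbourhood:
  assumes "seq_TC r X A \<noteq> \<infinity>"
  obtains U where "openin (power_space r X) U" "A \<subseteq> U" "seq_TC r X U = seq_TC r X A"
proof -
  obtain n where n: "seq_TC r X A = enat n"
    using assms by auto
  then obtain U where U: "\<forall>i<n. plannable r X (U i)" "A \<subseteq> (\<Union>i<n. U i)"
    using seq_TC_le_enat_iff by (metis order_refl)
  have "seq_TC r X (\<Union>i<n. U i) \<le> seq_TC r X A"
    using U(1) n seq_TC_le_enat_iff[of r X "\<Union>i<n. U i" n] by auto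
  then have "seq_TC r X (\<Union>i<n. U i) = seq_TC r X A"
    using seq_TC_mono[OF U(2)] by (rule antisym)
  moreover have "openin (power_space r X) (\<Union>i<n. U i)"
    using U(1) by (auto simp: plannable_def)
  ultimately show thesis
    using that U(2) by blast
qed

text \<open>A plannable cover of \<open>B\<close> pulls back along \<open>\<phi>\<close> to one of
  \<open>A\<close> with the same number of members.\<close>

lemma seq_TC_deformation:
  assumes "r \<ge> 2"
    and hom: "homotopic_with (\<lambda>_. True) (power_space r X) (power_space r X) \<phi> id"
    and "A \<subseteq> topspace (power_space r X)" "\<phi> ` A \<subseteq> B"
  shows "seq_TC r X A \<le> seq_TC r X B"
proof (rule enat_le_by_finite)
  fix n assume "seq_TC r X B = enat n"
  then obtain U where U: "\<forall>i<n. plannable r X (U i)" "B \<subseteq> (\<Union>i<n. U i)"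
    using seq_TC_le_enat_iff by (metis order_refl)
  let ?V = "\<lambda>i. {a \<in> topspace (power_space r X). \<phi> a \<in> U i}"
  have "\<forall>i<n. plannable r X (?V i)"
    using plannable_preimage[OF assms(1) _ hom] U(1) by blast
  moreover have "A \<subseteq> (\<Union>i<n. ?V i)"
    using U(2) assms(3,4) by blast
  ultimately show "seq_TC r X A \<le> enat n"
    unfolding seq_TC_le_enat_iff by (intro exI[of _ ?V] conjI)
qed

section \<open>Disjoint closed sets and connected components\<close>

text \<open>Normality gives disjoint open neighbourhoods \<open>P\<close> and \<open>Q\<close>. Two
  covers of common length \<open>n\<close> are shrunk into them and merged index by index, which
  costs the maximum instead of the sum.\<close>

lemma seq_TC_Un_disjnt_closed:
  assumes "normal_space (power_space r X)"
    and "closedin (power_space r X) A" "closedin (power_space r X) B" "disjnt A B"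
  shows "seq_TC r X (A \<union> B) \<le> max (seq_TC r X A) (seq_TC r X B)"
proof (rule enat_le_by_finite)
  fix n assume "max (seq_TC r X A) (seq_TC r X B) = enat n"
  then have "seq_TC r X A \<le> enat n" "seq_TC r X B \<le> enat n"
    using max.cobounded1[of "seq_TC r X A" "seq_TC r X B"] max.cobounded2[of "seq_TC r X B" "seq_TC r X A"]
    by simp_all
  then obtain U V where U: "\<forall>i<n. plannable r X (U i)" "A \<subseteq> (\<Union>i<n. U i)"
      and V: "\<forall>i<n. plannable r X (V i)" "B \<subseteq> (\<Union>i<n. V i)"
    unfolding seq_TC_le_enat_iff by blast
  obtain P Q where PQ: "openin (power_space r X) P" "openin (power_space r X) Q"
      "A \<subseteq> P" "B \<subseteq> Q" "disjnt P Q"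
    using assms(1)[unfolded normal_space_def, rule_format, of A B] assms(2-4) by blast
  let ?W = "\<lambda>i. U i \<inter> P \<union> V i \<inter> Q"
  have "plannable r X (?W i)" if "i < n" for i
  proof (intro plannable_Un_disjnt plannable_Int)
    show "plannable r X (U i)" "plannable r X (V i)"
      using U(1) V(1) that by blast+
    show "disjnt (U i \<inter> P) (V i \<inter> Q)"
      using PQ(5) unfolding disjnt_iff by blast
  qed (rule PQ)+
  then have "\<forall>i<n. plannable r X (?W i)"
    by blast
  moreover have "A \<union> B \<subseteq> (\<Union>i<n. ?W i)"
  proof (intro Un_least subsetI)
    fix a assume "a \<in> A"
    with U(2) PQ(3) obtain i where "i < n" "a \<in> U i" "a \<in> P"
      by fast
    then show "a \<in> (\<Union>i<n. ?W i)"
      by (intro UN_I[of i]) simp_all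
  next
    fix a assume "a \<in> B"
    with V(2) PQ(4) obtain i where "i < n" "a \<in> V i" "a \<in> Q"
      by fast
    then show "a \<in> (\<Union>i<n. ?W i)"
      by (intro UN_I[of i]) simp_all
  qed
  ultimately show "seq_TC r X (A \<union> B) \<le> enat n"
    unfolding seq_TC_le_enat_iff by (intro exI[of _ ?W] conjI)
qed

text \<open>Finiteness keeps the union of the remaining sets closed, so the case of two sets can be
  iterated. The inserted \<open>0\<close> is the value for the empty family.\<close>

lemma seq_TC_Union_disjnt_closed:
  assumes "finite \<C>" "normal_space (power_space r X)"
    and "\<And>C. C \<in> \<C> \<Longrightarrow> closedin (power_space r X) C" "pairwise disjnt \<C>"
  shows "seq_TC r X (\<Union>\<C>) \<le> Max (insert 0 (seq_TC r X ` \<C>))"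
  using assms
proof (induction \<C> rule: finite_induct)
  case empty
  then show ?case
    by (simp add: seq_TC_empty)
next
  case (insert C \<C>)
  have IH: "seq_TC r X (\<Union>\<C>) \<le> Max (insert 0 (seq_TC r X ` \<C>))"
    using insert by (auto simp: pairwise_insert)
  have "disjnt C (\<Union>\<C>)"
    using insert.prems(3) insert.hyps(2) by (auto simp: pairwise_insert disjnt_iff)
  moreover have "closedin (power_space r X) (\<Union>\<C>)"
    using insert by (intro closedin_Union) auto
  ultimately have "seq_TC r X (C \<union> \<Union>\<C>) \<le> max (seq_TC r X C) (seq_TC r X (\<Union>\<C>))"
    using insert.prems by (intro seq_TC_Un_disjnt_closed) auto
  also have "\<dots> \<le> max (seq_TC r X C) (Max (insert 0 (seq_TC r X ` \<C>)))"
    using IH by (rule max.mono[OF order_refl])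
  also have "\<dots> = Max (insert 0 (seq_TC r X ` insert C \<C>))"
    using insert.hyps by (simp add: insert_commute[of 0])
  finally show ?case
    by simp
qed

text \<open>Components are closed in the critical set, which is itself closed, so they form a finite
  disjoint family of closed sets in the power space.\<close>

lemma seq_TC_le_Max_fix_components:
  assumes "normal_space (power_space r X)" "closedin (power_space r X) (level (power_space r X) F c \<inter> fix_set (power_space r X) \<phi>)"
    and "finite (fix_components (power_space r X) \<phi> F c)"
  shows "seq_TC r X (level (power_space r X) F c \<inter> fix_set (power_space r X) \<phi>)
           \<le> Max (insert 0 (seq_TC r X ` fix_components (power_space r X) \<phi> F c))"
proof -
  let ?K = "level (power_space r X) F c \<inter> fix_set (power_space r X) \<phi>"
  have "\<Union> (fix_components (power_space r X) \<phi> F c) = ?K"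
    unfolding fix_components_def Union_connected_components_of topspace_subtopology
    using closedin_subset[OF assms(2)] by blast
  moreover have "seq_TC r X (\<Union> (fix_components (power_space r X) \<phi> F c))
      \<le> Max (insert 0 (seq_TC r X ` fix_components (power_space r X) \<phi> F c))"
    using assms(3,1)
  proof (rule seq_TC_Union_disjnt_closed)
    show "closedin (power_space r X) C" if "C \<in> fix_components (power_space r X) \<phi> F c" for C
      using that assms(2) unfolding fix_components_def
      by (blast intro: closedin_trans_full closedin_connected_components_of)
    show "pairwise disjnt (fix_components (power_space r X) \<phi> F c)"
      unfolding fix_components_def by (rule pairwise_disjoint_connected_components_of)
  qed
  ultimately show ?thesis
    by simp
qed

subsection \<open>Lyapunov functions\<close>

text \<open>The points outside \<open>U\<close> near level \<open>x\<close> that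
  \<open>\<phi>\<close> does not push far enough form a closed set without fixed points. The second
  clause of (D) then forbids the decrease of \<open>F\<close> from having infimum 0 there, so one
  application of \<open>\<phi>\<close> lowers \<open>F\<close> by a uniform amount.\<close>

lemma condition_D_deformation:
  assumes \<phi>: "continuous_map Y Y \<phi>" and F: "lyapunov_function Y \<phi> F" and D: "condition_D Y \<phi> F"
    and fin: "finite (F ` fix_set Y \<phi> \<inter> {..c})"
    and U: "openin Y U" "level Y F x \<inter> fix_set Y \<phi> \<subseteq> U"
  shows "\<exists>d>0. \<forall>a \<in> topspace Y - U. F a \<le> min c (x + d) \<longrightarrow> F (\<phi> a) \<le> x - d"
proof -
  have contF: "continuous_map Y euclideanreal F"
    and le: "\<And>a. a \<in> topspace Y \<Longrightarrow> F (\<phi> a) \<le> F a"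
    using F by (auto simp: lyapunov_function_def)
  \<comment> \<open>Only finitely many fixed-point values are at most \<open>c\<close>, so those
    different from \<open>x\<close> keep a positive distance from it; \<open>x\<close> itself may or
    may not be such a value.\<close>
  obtain d where d: "d > 0" and "\<forall>v \<in> F ` fix_set Y \<phi> \<inter> {..c}. v \<noteq> x \<longrightarrow> d \<le> dist x v"
    using finite_set_avoid[OF fin] by blast
  then have isol: "F y = x" if "y \<in> fix_set Y \<phi>" "F y \<le> c" "dist x (F y) < d" for y
    using that by (meson IntI atMost_iff imageI leD)
  \<comment> \<open>Halving turns the non-strict bounds that define \<open>A\<close> into the strict
    bound \<open>dist x (F y) < d\<close>.\<close>
  define e where "e = d / 2"
  have e: "e > 0" "e < d"
    using d by (auto simp: e_def)
  define A where "A = {a \<in> topspace Y. a \<notin> U \<and> F a \<le> min c (x + e) \<and> x - e \<le> F (\<phi> a)}"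
  have A: "A \<subseteq> topspace Y" "\<And>a. a \<in> A \<Longrightarrow> F a \<le> x + e \<and> x - e \<le> F (\<phi> a)"
    by (auto simp: A_def)
  have cF\<phi>: "continuous_map Y euclideanreal (\<lambda>a. F (\<phi> a))"
    using continuous_map_compose[OF \<phi> contF] by (simp add: o_def)
  have "A = (topspace Y - U) \<inter> {a \<in> topspace Y. F a \<in> {..min c (x + e)}}
              \<inter> {a \<in> topspace Y. F (\<phi> a) \<in> {x - e..}}"
    by (auto simp: A_def)
  also have "closedin Y \<dots>"
    using U(1) by (intro closedin_Int closedin_diff closedin_topspace
        closedin_continuous_map_preimage[OF contF] closedin_continuous_map_preimage[OF cF\<phi>]) auto
  finally have clA: "closedin Y A" .
  \<comment> \<open>At a fixed point both bounds in \<open>A\<close> concern the same value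
    \<open>F y\<close>, which isolation forces to be \<open>x\<close>; but fixed points at level
    \<open>x\<close> lie in \<open>U\<close>.\<close>
  have noA: "A \<inter> fix_set Y \<phi> = {}"
  proof (rule equals0I)
    fix y assume y: "y \<in> A \<inter> fix_set Y \<phi>"
    then have "dist x (F y) < d" "F y \<le> c"
      using e by (auto simp: A_def fix_set_def dist_real_def)
    then have "F y = x"
      using isol y by blast
    then show False
      using y U(2) by (auto simp: A_def level_def)
  qed
  have "\<exists>h>0. \<forall>a\<in>A. h \<le> F a - F (\<phi> a)"
  proof (cases "A = {}")
    case True
    then show ?thesis
      by (auto intro: exI[of _ 1])
  next
    case False
    have "bounded (F ` A)"
    proof (rule bounded_subset[of "{x - e..x + e}"])
      show "F ` A \<subseteq> {x - e..x + e}"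
        using A le by (force simp: subset_iff)
    qed simp
    moreover have "Y closure_of A \<inter> fix_set Y \<phi> = {}"
      using clA noA by (simp add: closure_of_closedin)
    ultimately have "(INF a\<in>A. F a - F (\<phi> a)) \<noteq> 0"
      using D False A(1) unfolding condition_D_def by blast
    moreover have nonneg: "0 \<le> F a - F (\<phi> a)" if "a \<in> A" for a
      using le A(1) that by auto
    moreover have "0 \<le> (INF a\<in>A. F a - F (\<phi> a))"
      by (rule cINF_greatest[OF False]) (rule nonneg)
    moreover have "bdd_below ((\<lambda>a. F a - F (\<phi> a)) ` A)"
      by (rule bdd_belowI2[of _ 0]) (rule nonneg)
    ultimately show ?thesis
      by (intro exI[of _ "INF a\<in>A. F a - F (\<phi> a)"]) (auto intro: cINF_lower)
  qed
  then obtain h where h: "h > 0" "\<And>a. a \<in> A \<Longrightarrow> h \<le> F a - F (\<phi> a)"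
    by blast
  \<comment> \<open>On \<open>A\<close>, starting at most \<open>h / 2\<close> above
    \<open>x\<close> and dropping by \<open>h\<close> ends at least \<open>h / 2\<close> below
    \<open>x\<close>. Off \<open>A\<close>, the image is already below \<open>x - e\<close>.\<close>
  have "F (\<phi> a) \<le> x - min e (h / 2)"
    if "a \<in> topspace Y - U" "F a \<le> min c (x + min e (h / 2))" for a
  proof (cases "a \<in> A")
    case True
    then show ?thesis
      using h(2)[OF True] that(2) by (auto simp: min_def split: if_splits)
  next
    case False
    then have "F (\<phi> a) < x - e"
      using that by (auto simp: A_def)
    then show ?thesis
      by linarith
  qed
  then show ?thesis
    using e h by (intro exI[of _ "min e (h / 2)"]) auto
qed

text \<open>The sublevel set is split into its part in an open neighbourhood \<open>U\<close> of the
  critical set, chosen with the same complexity, and the rest, which \<open>\<phi>\<close> carries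
  into the sublevel set at \<open>x - d\<close>.\<close>

lemma seq_TC_sublevel_step:
  assumes "r \<ge> 2"
    and hom: "homotopic_with (\<lambda>_. True) (power_space r X) (power_space r X) \<phi> id"
    and F: "lyapunov_function (power_space r X) \<phi> F" and D: "condition_D (power_space r X) \<phi> F"
    and fin: "finite (F ` fix_set (power_space r X) \<phi> \<inter> {..c})"
  shows "\<exists>d>0. \<forall>s \<le> min c (x + d). seq_TC r X (sublevel (power_space r X) F s)
           \<le> seq_TC r X (level (power_space r X) F x \<inter> fix_set (power_space r X) \<phi>)
              + seq_TC r X (sublevel (power_space r X) F (x - d))"
proof (cases "seq_TC r X (level (power_space r X) F x \<inter> fix_set (power_space r X) \<phi>) = \<infinity>")
  case True
  \<comment> \<open>The right-hand side is infinite, so any positive \<open>d\<close>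
    serves.\<close>
  then show ?thesis
    by (intro exI[of _ 1]) simp
next
  case False
  let ?Y = "power_space r X"
  let ?K = "level ?Y F x \<inter> fix_set ?Y \<phi>"
  have \<phi>: "continuous_map ?Y ?Y \<phi>"
    using homotopic_with_imp_continuous_maps[OF hom] by simp
  obtain U where U: "openin ?Y U" "?K \<subseteq> U" and TCU: "seq_TC r X U = seq_TC r X ?K"
    using seq_TC_open_neighbourhood[OF False] .
  obtain d where d: "d > 0"
      and dF: "\<And>a. a \<in> topspace ?Y - U \<Longrightarrow> F a \<le> min c (x + d) \<Longrightarrow> F (\<phi> a) \<le> x - d"
    using condition_D_deformation[OF \<phi> F D fin U] by blast
  have "seq_TC r X (sublevel ?Y F s) \<le> seq_TC r X ?K + seq_TC r X (sublevel ?Y F (x - d))"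
    if s: "s \<le> min c (x + d)" for s
  proof -
    have "seq_TC r X (sublevel ?Y F s) \<le> seq_TC r X (U \<union> (sublevel ?Y F s - U))"
      by (rule seq_TC_mono) blast
    also have "\<dots> \<le> seq_TC r X U + seq_TC r X (sublevel ?Y F s - U)"
      by (rule seq_TC_Un)
    also have "seq_TC r X (sublevel ?Y F s - U) \<le> seq_TC r X (sublevel ?Y F (x - d))"
    proof (rule seq_TC_deformation[OF assms(1) hom])
      show "sublevel ?Y F s - U \<subseteq> topspace ?Y"
        unfolding sublevel_def by blast
      have "\<phi> a \<in> sublevel ?Y F (x - d)" if "a \<in> sublevel ?Y F s - U" for a
      proof -
        have a: "a \<in> topspace ?Y - U" "F a \<le> min c (x + d)"
          using that s unfolding sublevel_def by auto
        then have "\<phi> a \<in> topspace ?Y"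
          using \<phi> unfolding continuous_map_def by blast
        then show ?thesis
          using dF[OF a] unfolding sublevel_def by blast
      qed
      then show "\<phi> ` (sublevel ?Y F s - U) \<subseteq> sublevel ?Y F (x - d)"
        by blast
    qed
    finally show ?thesis
      unfolding TCU by (simp add: add_left_mono)
  qed
  then show ?thesis
    using d by blast
qed

text \<open>Suppose the bound fails somewhere up to \<open>c\<close>, and let \<open>x\<close> be
  the infimum of the failing levels. It holds at \<open>x - d\<close> and fails at some
  \<open>s\<close> in \<open>[x, x + d)\<close>, but the step across \<open>x\<close> carries it
  from \<open>x - d\<close> to \<open>s\<close>.\<close>

lemma seq_TC_sublevel_le_sum:
  assumes "r \<ge> 2"
    and hom: "homotopic_with (\<lambda>_. True) (power_space r X) (power_space r X) \<phi> id"
    and F: "lyapunov_function (power_space r X) \<phi> F" and D: "condition_D (power_space r X) \<phi> F"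
    and bdd: "bdd_below (F ` topspace (power_space r X))"
    and fin: "finite (F ` fix_set (power_space r X) \<phi> \<inter> {..c})"
  shows "seq_TC r X (sublevel (power_space r X) F c)
           \<le> (\<Sum>\<mu>\<in>F ` fix_set (power_space r X) \<phi> \<inter> {..c}.
                seq_TC r X (level (power_space r X) F \<mu> \<inter> fix_set (power_space r X) \<phi>))"
proof -
  let ?Y = "power_space r X"
  let ?C = "F ` fix_set ?Y \<phi>"
  define w where "w = (\<lambda>\<mu>. seq_TC r X (level ?Y F \<mu> \<inter> fix_set ?Y \<phi>))"
  define f where "f = (\<lambda>t. seq_TC r X (sublevel ?Y F t))"
  define g where "g = (\<lambda>t. \<Sum>\<mu>\<in>?C \<inter> {..t}. w \<mu>)"
  have fin': "finite (?C \<inter> {..t})" if "t \<le> c" for t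
    using fin by (rule finite_subset[rotated]) (use that in auto)
  obtain m where m: "\<And>a. a \<in> topspace ?Y \<Longrightarrow> m \<le> F a"
    using bdd by (auto simp: bdd_below_def)
  define S where "S = {t. t \<le> c \<and> \<not> f t \<le> g t}"
  \<comment> \<open>Below the lower bound \<open>m\<close> of \<open>F\<close> the sublevel sets are
    empty and the estimate is trivial.\<close>
  have Sm: "m \<le> t" if "t \<in> S" for t
  proof (rule ccontr)
    assume "\<not> m \<le> t"
    then have "sublevel ?Y F t = {}"
      using m by (force simp: sublevel_def)
    then show False
      using that by (simp add: S_def f_def seq_TC_empty)
  qed
  have "S = {}"
  proof (rule ccontr)
    assume ne: "S \<noteq> {}"
    have bS: "bdd_below S"
      using Sm by (rule bdd_belowI)
    define x where "x = Inf S"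
    have xc: "x \<le> c"
      using ne bS by (auto simp: x_def S_def intro: cInf_lower2)
    obtain d where d: "d > 0" and step: "\<And>s. s \<le> min c (x + d) \<Longrightarrow> f s \<le> w x + f (x - d)"
      using seq_TC_sublevel_step[OF assms(1) hom F D fin, of x] unfolding f_def w_def by blast
    have "x - d \<notin> S"
      using cInf_lower[OF _ bS, of "x - d"] d by (auto simp: x_def)
    then have xd: "f (x - d) \<le> g (x - d)"
      using xc d by (auto simp: S_def)
    obtain s where s: "s \<in> S" "s < x + d"
      using cInf_lessD[OF ne, of "x + d"] d by (auto simp: x_def)
    have xs: "x \<le> s"
      using cInf_lower[OF s(1) bS] by (simp add: x_def)
    have sc: "s \<le> c"
      using s by (simp add: S_def)
    have "f s \<le> w x + f (x - d)"
      using step[of s] s sc by simp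
    also have "\<dots> \<le> w x + g (x - d)"
      using xd by (rule add_left_mono)
    \<comment> \<open>If \<open>x\<close> is a fixed-point value, its summand is counted in
      \<open>g s\<close> but not in \<open>g (x - d)\<close>; otherwise the critical set is empty
      and \<open>w x = 0\<close>.\<close>
    also have "\<dots> \<le> g s"
    proof (cases "x \<in> ?C")
      case True
      have "w x + g (x - d) = (\<Sum>\<mu>\<in>insert x (?C \<inter> {..x - d}). w \<mu>)"
        using fin'[of "x - d"] xc d by (simp add: g_def)
      also have "\<dots> \<le> g s"
        unfolding g_def using fin'[OF sc] True xs d by (intro sum_mono2) auto
      finally show ?thesis .
    next
      case False
      then have "level ?Y F x \<inter> fix_set ?Y \<phi> = {}"
        by (auto simp: level_def)
      then have "w x = 0"
        by (simp add: w_def seq_TC_empty)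
      moreover have "g (x - d) \<le> g s"
        unfolding g_def using fin'[OF sc] xs d by (intro sum_mono2) auto
      ultimately show ?thesis
        by simp
    qed
    finally show False
      using s(1) by (simp add: S_def)
  qed
  then show ?thesis
    by (auto simp: S_def f_def g_def w_def)
qed

section \<open>Infinite sums and conclusion\<close>

text \<open>The infinite sum is the supremum of the finite partial sums, and \<open>n\<close> points
  of \<open>B\<close> already contribute at least \<open>n\<close>.\<close>

lemma infsum_enat_eq_infinity:
  fixes f :: "'b \<Rightarrow> enat"
  assumes "infinite B" "B \<subseteq> A" "\<And>x. x \<in> B \<Longrightarrow> 1 \<le> f x"
  shows "infsum f A = \<infinity>"
proof -
  have "enat n \<le> infsum f A" for n
  proof -
    obtain N where N: "N \<subseteq> B" "finite N" "card N = n"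
      using infinite_arbitrarily_large[OF assms(1)] by blast
    have "enat n = (\<Sum>x\<in>N. 1)"
      using N by (simp add: of_nat_eq_enat)
    also have "\<dots> \<le> sum f N"
      using N assms(3) by (intro sum_mono) auto
    also have "\<dots> \<le> infsum f A"
      unfolding nonneg_infsum_complete[of A f, OF zero_le]
      by (rule SUP_upper) (use N assms(2) in auto)
    finally show ?thesis .
  qed
  then show ?thesis
    by (metis enat_ord_simps(1) Suc_n_not_le_n not_infinity_eq)
qed

theorem theorem2p8:
  fixes r :: nat
    and X :: "'a topology"
    and \<phi> :: "(nat \<Rightarrow> 'a) \<Rightarrow> (nat \<Rightarrow> 'a)"
    and F :: "(nat \<Rightarrow> 'a) \<Rightarrow> real"
  assumes "r \<ge> 2"
    and "path_connected_space X"
    and "ANR_space X"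
    and "continuous_map (power_space r X) (power_space r X) \<phi>"
    and "homotopic_with (\<lambda>_. True) (power_space r X) (power_space r X) \<phi> id"
    and "lyapunov_function (power_space r X) \<phi> F"
    and "bdd_below (F ` topspace (power_space r X))"
    and "discrete (F ` fix_set (power_space r X) \<phi>)"
    and "condition_D (power_space r X) \<phi> F"
  shows "(\<forall>c::real. seq_TC r X (sublevel (power_space r X) F c)
            \<le> (\<Sum>\<^sub>\<infinity>\<mu>\<in>{..c}. seq_TC r X (level (power_space r X) F \<mu> \<inter> fix_set (power_space r X) \<phi>)))
       \<and> (\<forall>c::real. (\<forall>\<mu>\<le>c. finite (fix_components (power_space r X) \<phi> F \<mu>)) \<longrightarrow>
            seq_TC r X (sublevel (power_space r X) F c)
            \<le> (\<Sum>\<^sub>\<infinity>\<mu>\<in>{..c}. Max (insert 0 (seq_TC r X ` fix_components (power_space r X) \<phi> F \<mu>))))"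
proof -
  let ?Y = "power_space r X"
  let ?C = "F ` fix_set ?Y \<phi>"
  let ?w = "\<lambda>\<mu>. seq_TC r X (level ?Y F \<mu> \<inter> fix_set ?Y \<phi>)"
  let ?v = "\<lambda>\<mu>. Max (insert 0 (seq_TC r X ` fix_components ?Y \<phi> F \<mu>))"
  have a: "seq_TC r X (sublevel ?Y F c) \<le> infsum ?w {..c}" for c
  proof (cases "finite (?C \<inter> {..c})")
    case True
    have "seq_TC r X (sublevel ?Y F c) \<le> sum ?w (?C \<inter> {..c})"
      using assms True by (intro seq_TC_sublevel_le_sum)
    also have "\<dots> \<le> infsum ?w {..c}"
      unfolding nonneg_infsum_complete[of "{..c}" ?w, OF zero_le]
      by (rule SUP_upper) (use True in auto)
    finally show ?thesis .
  next
    case False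
    \<comment> \<open>Each of the infinitely many fixed-point values carries a nonempty critical
      set, which contributes at least 1.\<close>
    have "infsum ?w {..c} = \<infinity>"
      using False
    proof (rule infsum_enat_eq_infinity)
      show "1 \<le> ?w \<mu>" if "\<mu> \<in> ?C \<inter> {..c}" for \<mu>
        using that by (intro seq_TC_ge_1) (auto simp: level_def fix_set_def)
    qed simp
    then show ?thesis
      by simp
  qed
  have "metrizable_space ?Y"
    using assms(3) by (auto simp: ANR_space_def metrizable_space_product_topology intro: countable_finite)
  then have "Hausdorff_space ?Y" and normal: "normal_space ?Y"
    by (simp_all add: metrizable_imp_Hausdorff_space metrizable_imp_normal_space)
  \<comment> \<open>The fixed-point set is the equalizer of \<open>\<phi>\<close> and the identity,
    hence closed in a Hausdorff space.\<close>
  then have fixed: "closedin ?Y (fix_set ?Y \<phi>)"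
    using closedin_continuous_maps_eq[OF _ assms(4) continuous_map_id] by (simp add: fix_set_def)
  have "closedin ?Y (level ?Y F \<mu>)" for \<mu>
    using assms(6) closedin_continuous_map_preimage[of ?Y euclideanreal F "{\<mu>}"]
    by (simp add: lyapunov_function_def level_def)
  then have w_v: "?w \<mu> \<le> ?v \<mu>" if "finite (fix_components ?Y \<phi> F \<mu>)" for \<mu>
    using that fixed by (intro seq_TC_le_Max_fix_components normal closedin_Int)
  have "seq_TC r X (sublevel ?Y F c) \<le> infsum ?v {..c}"
    if "\<forall>\<mu>\<le>c. finite (fix_components ?Y \<phi> F \<mu>)" for c
  proof -
    have "infsum ?w {..c} \<le> infsum ?v {..c}"
      using that w_v by (intro infsum_mono nonneg_summable_on_complete) auto
    with a show ?thesis
      by (rule order_trans)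
  qed
  with a show ?thesis
    by blast
qed

end
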